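(* Let $G$ be a simple matroid on the ground set $\{0,1,\ldots,n\}$, and for $i\in\{0,\ldots,n\}$ let $d_iG$ denote the pointed matroid with underlying matroid $G$ and base point $i$. Then for any $i,j\in\{0,\ldots,n\}$ we have $\mathcal{A}_d(d_iG)=\mathcal{A}_d(d_jG)$ as subalgebras of $\mathcal{A}(G)$.
   Context: For a simple matroid $G$ on a finite ground set $E$, let $\mathcal{E}=\Lambda(e_i : i\in E)$ be the graded exterior algebra over $\mathbb{C}$ with generators $e_i$ of degree one. For an ordered tuple $S=(i_1,\ldots,i_p)$ write $e_S=e_{i_1}\wedge\cdots\wedge e_{i_p}$, and define $\partial:\mathcal{E}^p\to\mathcal{E}^{p-1}$ by $\partial(e_{i_1}\wedge\cdots\wedge e_{i_p})=\sum_{k=1}^p(-1)^{k-1}e_{i_1}\wedge\cdots\wedge\widehat{e_{i_k}}\wedge\cdots\wedge e_{i_p}$. Let $\mathcal{I}$ be the ideal generated by $\{\partial e_S : S \text{ dependent in } G\}$, and let $\mathcal{A}(G)=\mathcal{E}/\mathcal{I}$ be the Orlik-Solomon algebra, with $a_k$ the image of $e_k$. For the pointed matroid $d_iG$ (base point $i$), its Orlik-Solomon algebra $\mathcal{A}_d(d_iG)$ is the subalgebra of $\mathcal{A}(G)$ generated by $\{a_k-a_i : k\in\{0,\ldots,n\},\ k\neq i\}$. *)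

theory Defs
  imports Complex_Main "HOL.Hull" "HOL-Algebra.QuotRing" "HOL-Algebra.Module" "HOL-Algebra.Subrings"
begin

section \<open>Matroids\<close>

record 'a set_system =
  ground :: "'a set"
  indep :: "'a set set"

definition matroid :: "'a set_system \<Rightarrow> bool" where
  "matroid G \<longleftrightarrow>
     finite (ground G) \<and> indep G \<subseteq> Pow (ground G) \<and> {} \<in> indep G \<and>
     (\<forall>X Y. X \<in> indep G \<and> Y \<subseteq> X \<longrightarrow> Y \<in> indep G) \<and>
     (\<forall>X Y. X \<in> indep G \<and> Y \<in> indep G \<and> card X < card Y \<longrightarrow>
        (\<exists>y \<in> Y - X. insert y X \<in> indep G))"

definition circuit :: "'a set_system \<Rightarrow> 'a set \<Rightarrow> bool" where
  "circuit G C \<longleftrightarrow> C \<subseteq> ground G \<and> C \<notin> indep G \<and> (\<forall>D. D \<subset> C \<longrightarrow> D \<in> indep G)"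

text \<open>Simple: neither loops (one-element circuits) nor parallel elements (two-element circuits).\<close>

definition simple_matroid :: "'a set_system \<Rightarrow> bool" where
  "simple_matroid G \<longleftrightarrow> matroid G \<and> (\<forall>C. circuit G C \<longrightarrow> card C \<noteq> 1 \<and> card C \<noteq> 2)"

text \<open>A tuple with a repeated entry counts as dependent; it contributes nothing to the
  Orlik-Solomon ideal, since its wedge product vanishes.\<close>

definition dependent_tuple :: "'a set_system \<Rightarrow> 'a list \<Rightarrow> bool" where
  "dependent_tuple G xs \<longleftrightarrow> set xs \<subseteq> ground G \<and> \<not> (distinct xs \<and> set xs \<in> indep G)"

record 'a pointed_matroid =
  underlying :: "'a set_system"
  base_point :: 'a

definition pointed_at :: "'a \<Rightarrow> 'a set_system \<Rightarrow> 'a pointed_matroid" where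
  "pointed_at i G = \<lparr>underlying = G, base_point = i\<rparr>"


section \<open>Complex algebras\<close>

text \<open>The locale \<^locale>\<open>algebra\<close> requires a commutative multiplication. A not necessarily
  commutative unital \<open>\<complex>\<close>-algebra is treated here as a record of type \<^typ>\<open>(complex, 'b) module\<close> that is a
  ring, a module over \<open>complex_ring\<close>, and has a bilinear product.\<close>

definition complex_ring :: "complex ring" where
  "complex_ring = \<lparr>carrier = UNIV, mult = (*), one = 1, zero = 0, add = (+)\<rparr>"

definition complex_algebra :: "(complex, 'b) module \<Rightarrow> bool" where
  "complex_algebra A \<longleftrightarrow> ring A \<and> module complex_ring A \<and>
     (\<forall>c. \<forall>x \<in> carrier A. \<forall>y \<in> carrier A.
        (c \<odot>\<^bsub>A\<^esub> x) \<otimes>\<^bsub>A\<^esub> y = c \<odot>\<^bsub>A\<^esub> (x \<otimes>\<^bsub>A\<^esub> y) \<and> x \<otimes>\<^bsub>A\<^esub> (c \<odot>\<^bsub>A\<^esub> y) = c \<odot>\<^bsub>A\<^esub> (x \<otimes>\<^bsub>A\<^esub> y))"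

definition complex_subalgebra :: "'b set \<Rightarrow> (complex, 'b) module \<Rightarrow> bool" where
  "complex_subalgebra H A \<longleftrightarrow> subring H A \<and> submodule H complex_ring A"

definition generated_subalgebra :: "(complex, 'b) module \<Rightarrow> 'b set \<Rightarrow> 'b set" where
  "generated_subalgebra A X = (\<lambda>H. complex_subalgebra H A) hull X"

text \<open>The quotient ring, with \<open>c \<odot> (I + x) = I + c \<odot> x\<close>, written in the style of
  \<^const>\<open>rcoset_mult\<close>.\<close>

definition quotient_algebra :: "(complex, 'b) module \<Rightarrow> 'b set \<Rightarrow> (complex, 'b set) module" where
  "quotient_algebra A I =
     ring.extend (A Quot I) (module.fields (\<lambda>c X. \<Union>x\<in>X. I +>\<^bsub>A\<^esub> (c \<odot>\<^bsub>A\<^esub> x)))"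


section \<open>The exterior algebra on a finite set\<close>

text \<open>An element is given by its coordinates with respect to the basis
  \<open>e\<^sub>S = e\<^bsub>i\<^sub>1\<^esub> \<and> \<dots> \<and> e\<^bsub>i\<^sub>p\<^esub>\<close>, where \<open>S = {i\<^sub>1 < \<dots> < i\<^sub>p}\<close> runs over the subsets of \<open>E\<close>.
  For disjoint \<open>S\<close>, \<open>T\<close> one has \<open>e\<^sub>S \<and> e\<^sub>T = ext_sign S T e\<^bsub>S \<union> T\<^esub>\<close>; the order on the index type
  only enters the choice of signs of the basis vectors.\<close>

definition ext_sign :: "'a::linorder set \<Rightarrow> 'a set \<Rightarrow> complex" where
  "ext_sign S T = (-1) ^ card {(s, t). s \<in> S \<and> t \<in> T \<and> t < s}"

definition exterior_algebra :: "'a::linorder set \<Rightarrow> (complex, 'a set \<Rightarrow> complex) module" where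
  "exterior_algebra E =
     \<lparr>carrier = {x. \<forall>S. \<not> S \<subseteq> E \<longrightarrow> x S = 0},
      mult = (\<lambda>x y S. \<Sum>T\<in>Pow S. ext_sign T (S - T) * x T * y (S - T)),
      one = (\<lambda>S. if S = {} then 1 else 0),
      zero = (\<lambda>S. 0),
      add = (\<lambda>x y S. x S + y S),
      smult = (\<lambda>c x S. c * x S)\<rparr>"

definition ext_gen :: "'a \<Rightarrow> 'a set \<Rightarrow> complex" where
  "ext_gen i = (\<lambda>S. if S = {i} then 1 else 0)"

definition wedge :: "'a::linorder set \<Rightarrow> 'a list \<Rightarrow> 'a set \<Rightarrow> complex" where
  "wedge E xs = foldr (\<lambda>i x. ext_gen i \<otimes>\<^bsub>exterior_algebra E\<^esub> x) xs \<one>\<^bsub>exterior_algebra E\<^esub>"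

definition boundary_tuple :: "'a::linorder set \<Rightarrow> 'a list \<Rightarrow> 'a set \<Rightarrow> complex" where
  "boundary_tuple E xs =
     (\<Oplus>\<^bsub>exterior_algebra E\<^esub> k \<in> {..<length xs}.
        (-1) ^ k \<odot>\<^bsub>exterior_algebra E\<^esub> wedge E (take k xs @ drop (Suc k) xs))"

text \<open>The linear map with \<open>\<partial> e\<^sub>S = boundary_tuple E (i\<^sub>1, \<dots>, i\<^sub>p)\<close> on the basis. That the same formula
  then holds for arbitrary tuples is lemma \<open>boundary_wedge\<close> below.\<close>

definition boundary :: "'a::linorder set \<Rightarrow> ('a set \<Rightarrow> complex) \<Rightarrow> 'a set \<Rightarrow> complex" where
  "boundary E x =
     (\<Oplus>\<^bsub>exterior_algebra E\<^esub> S \<in> Pow E.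
        x S \<odot>\<^bsub>exterior_algebra E\<^esub> boundary_tuple E (sorted_list_of_set S))"


section \<open>Orlik-Solomon algebras\<close>

definition OS_ideal :: "'a::linorder set_system \<Rightarrow> ('a set \<Rightarrow> complex) set" where
  "OS_ideal G =
     Idl\<^bsub>exterior_algebra (ground G)\<^esub>
       {boundary (ground G) (wedge (ground G) xs) | xs. dependent_tuple G xs}"

definition OS_algebra :: "'a::linorder set_system \<Rightarrow> (complex, ('a set \<Rightarrow> complex) set) module" where
  "OS_algebra G = quotient_algebra (exterior_algebra (ground G)) (OS_ideal G)"

definition OS_gen :: "'a::linorder set_system \<Rightarrow> 'a \<Rightarrow> ('a set \<Rightarrow> complex) set" where
  "OS_gen G k = OS_ideal G +>\<^bsub>exterior_algebra (ground G)\<^esub> ext_gen k"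

definition pointed_OS_algebra :: "'a::linorder pointed_matroid \<Rightarrow> ('a set \<Rightarrow> complex) set set" where
  "pointed_OS_algebra P =
     (let G = underlying P; i = base_point P in
        generated_subalgebra (OS_algebra G)
          {OS_gen G k \<ominus>\<^bsub>OS_algebra G\<^esub> OS_gen G i | k. k \<in> ground G \<and> k \<noteq> i})"


section \<open>Well-definedness\<close>

subsection \<open>The exterior algebra is a complex algebra\<close>

lemma cring_complex_ring: "cring complex_ring"
  by (rule cringI)
    (auto simp: complex_ring_def algebra_simps
      intro!: abelian_groupI comm_monoidI exI[of _ "- x" for x] ab_left_minus)

lemma ext_sign_Un_left:
  assumes "finite S" "finite S'" "finite T" "S \<inter> S' = {}"
  shows "ext_sign (S \<union> S') T = ext_sign S T * ext_sign S' T"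
proof -
  have "{(s, t). s \<in> S \<union> S' \<and> t \<in> T \<and> t < s} =
      {(s, t). s \<in> S \<and> t \<in> T \<and> t < s} \<union> {(s, t). s \<in> S' \<and> t \<in> T \<and> t < s}"
    by auto
  moreover have "finite {(s, t). s \<in> S \<and> t \<in> T \<and> t < s}"
      "finite {(s, t). s \<in> S' \<and> t \<in> T \<and> t < s}"
    by (rule finite_subset[of _ "S \<times> T"] finite_subset[of _ "S' \<times> T"]; use assms in auto)+
  moreover have "{(s, t). s \<in> S \<and> t \<in> T \<and> t < s} \<inter> {(s, t). s \<in> S' \<and> t \<in> T \<and> t < s} = {}"
    using assms by auto
  ultimately show ?thesis
    by (simp add: ext_sign_def card_Un_disjoint power_add)
qed

lemma ext_sign_Un_right:
  assumes "finite S" "finite T" "finite T'" "T \<inter> T' = {}"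
  shows "ext_sign S (T \<union> T') = ext_sign S T * ext_sign S T'"
proof -
  have "{(s, t). s \<in> S \<and> t \<in> T \<union> T' \<and> t < s} =
      {(s, t). s \<in> S \<and> t \<in> T \<and> t < s} \<union> {(s, t). s \<in> S \<and> t \<in> T' \<and> t < s}"
    by auto
  moreover have "finite {(s, t). s \<in> S \<and> t \<in> T \<and> t < s}"
      "finite {(s, t). s \<in> S \<and> t \<in> T' \<and> t < s}"
    by (rule finite_subset[of _ "S \<times> T"] finite_subset[of _ "S \<times> T'"]; use assms in auto)+
  moreover have "{(s, t). s \<in> S \<and> t \<in> T \<and> t < s} \<inter> {(s, t). s \<in> S \<and> t \<in> T' \<and> t < s} = {}"
    using assms by auto
  ultimately show ?thesis
    by (simp add: ext_sign_def card_Un_disjoint power_add)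
qed

lemma ext_sign_empty [simp]: "ext_sign {} T = 1" "ext_sign S {} = 1"
  by (simp_all add: ext_sign_def)

lemma exterior_algebra_simps [simp]:
  "x \<in> carrier (exterior_algebra E) \<longleftrightarrow> (\<forall>S. \<not> S \<subseteq> E \<longrightarrow> x S = 0)"
  "(x \<otimes>\<^bsub>exterior_algebra E\<^esub> y) S = (\<Sum>T\<in>Pow S. ext_sign T (S - T) * x T * y (S - T))"
  "\<one>\<^bsub>exterior_algebra E\<^esub> S = (if S = {} then 1 else 0)"
  "\<zero>\<^bsub>exterior_algebra E\<^esub> S = 0"
  "(x \<oplus>\<^bsub>exterior_algebra E\<^esub> y) S = x S + y S"
  "(c \<odot>\<^bsub>exterior_algebra E\<^esub> x) S = c * x S"
  by (simp_all add: exterior_algebra_def)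

lemma ext_mult_closed:
  assumes "x \<in> carrier (exterior_algebra E)" "y \<in> carrier (exterior_algebra E)"
  shows "x \<otimes>\<^bsub>exterior_algebra E\<^esub> y \<in> carrier (exterior_algebra E)"
proof -
  have "ext_sign T (S - T) * x T * y (S - T) = 0" if "\<not> S \<subseteq> E" "T \<subseteq> S" for S T
  proof -
    have "\<not> T \<subseteq> E \<or> \<not> S - T \<subseteq> E" using that by blast
    then show ?thesis
      using assms by (metis exterior_algebra_simps(1) mult_zero_left mult_zero_right)
  qed
  then show ?thesis
    unfolding exterior_algebra_simps(1,2) by (intro allI impI sum.neutral ballI) (simp only: Pow_iff)
qed

lemma ext_mult_assoc:
  assumes "finite S"
  shows "(x \<otimes>\<^bsub>exterior_algebra E\<^esub> y \<otimes>\<^bsub>exterior_algebra E\<^esub> z) S =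
    (x \<otimes>\<^bsub>exterior_algebra E\<^esub> (y \<otimes>\<^bsub>exterior_algebra E\<^esub> z)) S"
proof -
  have "(x \<otimes>\<^bsub>exterior_algebra E\<^esub> y \<otimes>\<^bsub>exterior_algebra E\<^esub> z) S =
      (\<Sum>T\<in>Pow S. \<Sum>U\<in>Pow T.
         ext_sign T (S - T) * (ext_sign U (T - U) * x U * y (T - U)) * z (S - T))"
    by (simp add: sum_distrib_left sum_distrib_right)
  also have "\<dots> = (\<Sum>(T, U)\<in>Sigma (Pow S) Pow.
         ext_sign T (S - T) * (ext_sign U (T - U) * x U * y (T - U)) * z (S - T))"
    by (rule sum.Sigma) (use assms in \<open>auto intro: finite_subset\<close>)
  also have "\<dots> = (\<Sum>(U, V)\<in>Sigma (Pow S) (\<lambda>U. Pow (S - U)).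
         ext_sign U (S - U) * x U * (ext_sign V (S - U - V) * y V * z (S - U - V)))"
  proof (rule sum.reindex_bij_witness[where i = "\<lambda>(U, V). (U \<union> V, U)" and j = "\<lambda>(T, U). (U, T - U)"])
    fix p assume "p \<in> Sigma (Pow S) Pow"
    then obtain T U where p: "p = (T, U)" and *: "T \<subseteq> S" "U \<subseteq> T" by auto
    have fin: "finite U" "finite (T - U)" "finite (S - T)"
      using * assms by (auto intro: finite_subset)
    have "ext_sign T (S - T) = ext_sign U (S - T) * ext_sign (T - U) (S - T)"
      using ext_sign_Un_left[of U "T - U" "S - T"] fin * by (simp add: Un_absorb1)
    moreover have "ext_sign U (S - U) = ext_sign U (T - U) * ext_sign U (S - T)"
    proof -
      have "S - U = (T - U) \<union> (S - T)" "(T - U) \<inter> (S - T) = {}" using * by auto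
      then show ?thesis using ext_sign_Un_right[of U "T - U" "S - T"] fin by simp
    qed
    moreover have "S - U - (T - U) = S - T" using * by auto
    ultimately show "(case (case p of (T, U) \<Rightarrow> (U, T - U)) of (U, V) \<Rightarrow>
          ext_sign U (S - U) * x U * (ext_sign V (S - U - V) * y V * z (S - U - V))) =
        (case p of (T, U) \<Rightarrow>
          ext_sign T (S - T) * (ext_sign U (T - U) * x U * y (T - U)) * z (S - T))"
      by (simp add: p)
  qed auto
  also have "\<dots> = (\<Sum>U\<in>Pow S. \<Sum>V\<in>Pow (S - U).
         ext_sign U (S - U) * x U * (ext_sign V (S - U - V) * y V * z (S - U - V)))"
    by (rule sum.Sigma[symmetric]) (use assms in \<open>auto intro: finite_subset\<close>)
  also have "\<dots> = (x \<otimes>\<^bsub>exterior_algebra E\<^esub> (y \<otimes>\<^bsub>exterior_algebra E\<^esub> z)) S"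
    by (simp add: sum_distrib_left)
  finally show ?thesis .
qed

lemma abelian_group_exterior_algebra: "abelian_group (exterior_algebra E)"
proof (rule abelian_groupI)
  fix x assume "x \<in> carrier (exterior_algebra E)"
  then show "\<exists>y\<in>carrier (exterior_algebra E). y \<oplus>\<^bsub>exterior_algebra E\<^esub> x = \<zero>\<^bsub>exterior_algebra E\<^esub>"
    by (intro bexI[of _ "\<lambda>S. - x S"]) (auto simp: fun_eq_iff)
qed (auto simp: fun_eq_iff)

lemma ext_one_mult:
  assumes "finite E" "x \<in> carrier (exterior_algebra E)"
  shows "\<one>\<^bsub>exterior_algebra E\<^esub> \<otimes>\<^bsub>exterior_algebra E\<^esub> x = x"
    and "x \<otimes>\<^bsub>exterior_algebra E\<^esub> \<one>\<^bsub>exterior_algebra E\<^esub> = x"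
proof -
  have "(\<Sum>T\<in>Pow S. ext_sign T (S - T) * (if T = {} then 1 else 0) * x (S - T)) = x S
      \<and> (\<Sum>T\<in>Pow S. ext_sign T (S - T) * x T * (if S \<subseteq> T then 1 else 0)) = x S" for S
  proof (cases "finite S")
    case True
    have "(\<Sum>T\<in>Pow S. ext_sign T (S - T) * (if T = {} then 1 else 0) * x (S - T)) =
        (\<Sum>T\<in>Pow S. if T = {} then x S else 0)"
      by (intro sum.cong) auto
    moreover have "(\<Sum>T\<in>Pow S. ext_sign T (S - T) * x T * (if S \<subseteq> T then 1 else 0)) =
        (\<Sum>T\<in>Pow S. if T = S then x S else 0)"
      by (intro sum.cong) auto
    ultimately show ?thesis
      using True by (simp add: sum.delta)
  next
    case False
    then show ?thesis using assms by (auto dest: finite_subset)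
  qed
  then show "\<one>\<^bsub>exterior_algebra E\<^esub> \<otimes>\<^bsub>exterior_algebra E\<^esub> x = x"
    and "x \<otimes>\<^bsub>exterior_algebra E\<^esub> \<one>\<^bsub>exterior_algebra E\<^esub> = x"
    by (auto simp: fun_eq_iff)
qed

lemma ring_exterior_algebra:
  assumes "finite E"
  shows "ring (exterior_algebra E)"
proof (rule ringI)
  show "monoid (exterior_algebra E)"
  proof (rule monoidI)
    fix x y z
    assume *: "x \<in> carrier (exterior_algebra E)" "y \<in> carrier (exterior_algebra E)"
      "z \<in> carrier (exterior_algebra E)"
    show "x \<otimes>\<^bsub>exterior_algebra E\<^esub> y \<otimes>\<^bsub>exterior_algebra E\<^esub> z =
      x \<otimes>\<^bsub>exterior_algebra E\<^esub> (y \<otimes>\<^bsub>exterior_algebra E\<^esub> z)"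
    proof
      fix S show "(x \<otimes>\<^bsub>exterior_algebra E\<^esub> y \<otimes>\<^bsub>exterior_algebra E\<^esub> z) S =
        (x \<otimes>\<^bsub>exterior_algebra E\<^esub> (y \<otimes>\<^bsub>exterior_algebra E\<^esub> z)) S"
        by (cases "finite S") (rule ext_mult_assoc, simp, simp)
    qed
  qed (auto simp: ext_mult_closed ext_one_mult assms simp del: exterior_algebra_simps(1,2), simp)
qed (auto simp: abelian_group_exterior_algebra fun_eq_iff ring_distribs sum.distrib)

lemma complex_algebra_exterior_algebra:
  assumes "finite E"
  shows "complex_algebra (exterior_algebra E)"
  unfolding complex_algebra_def
proof (intro conjI allI ballI)
  show "module complex_ring (exterior_algebra E)"
    by (rule moduleI)
      (auto simp: cring_complex_ring abelian_group_exterior_algebra, 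
       auto simp: complex_ring_def fun_eq_iff algebra_simps)
qed (auto simp: ring_exterior_algebra[OF assms] fun_eq_iff sum_distrib_left mult_ac)

lemma ext_gen_closed: "i \<in> E \<Longrightarrow> ext_gen i \<in> carrier (exterior_algebra E)"
  by (auto simp: ext_gen_def)

lemma ext_gen_apply: "ext_gen i S = (if S = {i} then 1 else 0)"
  by (simp add: ext_gen_def)

lemma wedge_Nil: "wedge E [] = \<one>\<^bsub>exterior_algebra E\<^esub>"
  and wedge_Cons: "wedge E (i # xs) = ext_gen i \<otimes>\<^bsub>exterior_algebra E\<^esub> wedge E xs"
  by (simp_all add: wedge_def)

lemma wedge_closed: "set xs \<subseteq> E \<Longrightarrow> wedge E xs \<in> carrier (exterior_algebra E)"
  by (induction xs)
    (auto simp: wedge_Nil wedge_Cons simp del: exterior_algebra_simps(1,2)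
      intro!: ext_mult_closed ext_gen_closed, simp)

lemma finsum_exterior_algebra_apply:
  assumes "f \<in> A \<rightarrow> carrier (exterior_algebra E)"
  shows "(\<Oplus>\<^bsub>exterior_algebra E\<^esub> k\<in>A. f k) S = (\<Sum>k\<in>A. f k S)"
proof -
  interpret abelian_group "exterior_algebra E"
    by (rule abelian_group_exterior_algebra)
  show ?thesis
    using assms
  proof (induction A rule: infinite_finite_induct)
    case (insert a A)
    then have "f \<in> A \<rightarrow> carrier (exterior_algebra E)" "f a \<in> carrier (exterior_algebra E)"
      by blast+
    then show ?case using insert by (simp del: exterior_algebra_simps(1))
  qed (simp_all add: finsum_infinite)
qed

lemma ext_gen_mult:
  assumes "finite S"
  shows "(ext_gen i \<otimes>\<^bsub>exterior_algebra E\<^esub> x) S =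
    (if i \<in> S then ext_sign {i} (S - {i}) * x (S - {i}) else 0)"
proof -
  have "(ext_gen i \<otimes>\<^bsub>exterior_algebra E\<^esub> x) S =
      (\<Sum>T\<in>Pow S. if T = {i} then ext_sign {i} (S - {i}) * x (S - {i}) else 0)"
    by (auto simp: ext_gen_def intro!: sum.cong)
  then show ?thesis using assms by (simp add: sum.delta)
qed

lemma ext_sign_singleton: "ext_sign {i} T = (-1) ^ card {t \<in> T. t < i}"
proof -
  have "{(s, t). s \<in> {i} \<and> t \<in> T \<and> t < s} = (\<lambda>t. (i, t)) ` {t \<in> T. t < i}" by auto
  then show ?thesis by (simp add: ext_sign_def card_image inj_on_def)
qed

lemma ext_sign_singleton_insert:
  assumes "finite T" "j \<notin> T"
  shows "ext_sign {i} (insert j T) = (if j < i then - 1 else 1) * ext_sign {i} T"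
proof -
  have "{t \<in> insert j T. t < i} =
      (if j < i then insert j {t \<in> T. t < i} else {t \<in> T. t < i})" by auto
  then show ?thesis using assms by (simp add: ext_sign_singleton)
qed

lemma ext_sign_singleton_square: "ext_sign {i} T * ext_sign {i} T = 1"
  by (simp add: ext_sign_singleton flip: power_add mult_2)

lemma ext_gen_square: "ext_gen i \<otimes>\<^bsub>exterior_algebra E\<^esub> ext_gen i = \<zero>\<^bsub>exterior_algebra E\<^esub>"
proof
  fix S show "(ext_gen i \<otimes>\<^bsub>exterior_algebra E\<^esub> ext_gen i) S = \<zero>\<^bsub>exterior_algebra E\<^esub> S"
  proof (cases "finite S")
    case True
    have "ext_gen i (S - {i}) = 0" by (auto simp: ext_gen_def)
    then show ?thesis
      using True by (simp add: ext_gen_mult del: exterior_algebra_simps(2))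
  qed simp
qed

lemma ext_gen_anticommute:
  assumes "i \<noteq> j"
  shows "(ext_gen i \<otimes>\<^bsub>exterior_algebra E\<^esub> ext_gen j) \<oplus>\<^bsub>exterior_algebra E\<^esub>
    (ext_gen j \<otimes>\<^bsub>exterior_algebra E\<^esub> ext_gen i) = \<zero>\<^bsub>exterior_algebra E\<^esub>"
proof
  fix S
  show "((ext_gen i \<otimes>\<^bsub>exterior_algebra E\<^esub> ext_gen j) \<oplus>\<^bsub>exterior_algebra E\<^esub>
    (ext_gen j \<otimes>\<^bsub>exterior_algebra E\<^esub> ext_gen i)) S = \<zero>\<^bsub>exterior_algebra E\<^esub> S"
  proof (cases "finite S")
    case True
    show ?thesis
    proof (cases "S = {i, j}")
      case True
      then have "S - {i} = {j}" "S - {j} = {i}" using assms by auto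
      moreover have "ext_sign {i} {j} + ext_sign {j} {i} = 0"
        using assms ext_sign_singleton_insert[of "{}" j i] ext_sign_singleton_insert[of "{}" i j]
        by auto
      ultimately show ?thesis
        using \<open>finite S\<close> True by (simp add: ext_gen_mult ext_gen_apply del: exterior_algebra_simps(2))
    next
      case False
      then have "\<not> (i \<in> S \<and> S - {i} = {j})" "\<not> (j \<in> S \<and> S - {j} = {i})" by auto
      then show ?thesis
        using \<open>finite S\<close> by (auto simp: ext_gen_mult ext_gen_apply simp del: exterior_algebra_simps(2))
    qed
  qed simp
qed


subsection \<open>The boundary map\<close>

lemma wedge_sorted:
  assumes "sorted_wrt (<) xs"
  shows "wedge E xs S = (if S = set xs then 1 else 0)"
  using assms
proof (induction xs arbitrary: S)
  case Nil
  then show ?case by (simp add: wedge_Nil)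
next
  case (Cons i xs)
  show ?case
  proof (cases "finite S")
    case True
    have "{t \<in> set xs. t < i} = {}" "i \<notin> set xs" using Cons.prems by auto
    then have "ext_sign {i} (set xs) = 1" by (simp only: ext_sign_singleton) simp
    moreover have "S = insert i (set xs) \<longleftrightarrow> i \<in> S \<and> S - {i} = set xs"
      using \<open>i \<notin> set xs\<close> by auto
    moreover have "wedge E xs T = (if T = set xs then 1 else 0)" for T
      using Cons by simp
    ultimately show ?thesis
      using True by (simp add: wedge_Cons ext_gen_mult del: exterior_algebra_simps(2))
  next
    case False
    then show ?thesis by (auto simp: wedge_Cons)
  qed
qed

lemma set_delete_nth: "set (take k xs @ drop (Suc k) xs) \<subseteq> set xs"
  using set_take_subset[of k xs] set_drop_subset[of "Suc k" xs] by auto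

lemma wedge_delete_nth_closed:
  assumes "set xs \<subseteq> E"
  shows "wedge E (take k xs @ drop (Suc k) xs) \<in> carrier (exterior_algebra E)"
  by (rule wedge_closed) (rule order_trans[OF set_delete_nth assms])

lemma ext_smult_closed:
  "x \<in> carrier (exterior_algebra E) \<Longrightarrow> c \<odot>\<^bsub>exterior_algebra E\<^esub> x \<in> carrier (exterior_algebra E)"
  by simp

lemma boundary_tuple_apply:
  assumes "set xs \<subseteq> E"
  shows "boundary_tuple E xs S =
    (\<Sum>k<length xs. (-1) ^ k * wedge E (take k xs @ drop (Suc k) xs) S)"
  unfolding boundary_tuple_def
  by (subst finsum_exterior_algebra_apply)
    (intro Pi_I ext_smult_closed wedge_delete_nth_closed assms,
      simp only: exterior_algebra_simps(6))

lemma boundary_tuple_closed: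
  assumes "set xs \<subseteq> E"
  shows "boundary_tuple E xs \<in> carrier (exterior_algebra E)"
proof -
  interpret abelian_group "exterior_algebra E"
    by (rule abelian_group_exterior_algebra)
  show ?thesis
    unfolding boundary_tuple_def
    by (intro finsum_closed Pi_I ext_smult_closed wedge_delete_nth_closed assms)
qed

lemma boundary_tuple_Cons:
  assumes "insert i (set xs) \<subseteq> E" "finite S"
  shows "boundary_tuple E (i # xs) S =
    wedge E xs S - (ext_gen i \<otimes>\<^bsub>exterior_algebra E\<^esub> boundary_tuple E xs) S"
proof -
  let ?d = "\<lambda>k. wedge E (take k xs @ drop (Suc k) xs)"
  have sub: "set (i # xs) \<subseteq> E" "set xs \<subseteq> E" using assms(1) by auto
  have "boundary_tuple E (i # xs) S =
      wedge E xs S + (\<Sum>k<length xs. (-1) ^ Suc k * wedge E (i # take k xs @ drop (Suc k) xs) S)"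
    unfolding boundary_tuple_apply[OF sub(1)] length_Cons sum.lessThan_Suc_shift by simp
  also have "(\<Sum>k<length xs. (-1) ^ Suc k * wedge E (i # take k xs @ drop (Suc k) xs) S) =
      - (if i \<in> S then ext_sign {i} (S - {i}) * (\<Sum>k<length xs. (-1) ^ k * ?d k (S - {i})) else 0)"
  proof (cases "i \<in> S")
    case True
    then show ?thesis
      unfolding wedge_Cons ext_gen_mult[OF assms(2)] sum_distrib_left sum_negf[symmetric] if_P[OF True]
      by (intro sum.cong refl) (simp only: power_Suc mult_minus_left mult_1_left mult_ac)
  qed (simp add: wedge_Cons ext_gen_mult[OF assms(2)] del: exterior_algebra_simps(2))
  also have "\<dots> = - (ext_gen i \<otimes>\<^bsub>exterior_algebra E\<^esub> boundary_tuple E xs) S"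
    unfolding ext_gen_mult[OF assms(2)] boundary_tuple_apply[OF sub(2)] by (rule refl)
  finally show ?thesis by (simp only: diff_conv_add_uminus)
qed

text \<open>The boundary map in coordinates.\<close>

definition boundary_coord :: "'a::linorder set \<Rightarrow> ('a set \<Rightarrow> complex) \<Rightarrow> 'a set \<Rightarrow> complex" where
  "boundary_coord E x T = (\<Sum>l\<in>E - T. ext_sign {l} T * x (insert l T))"

lemma boundary_coord_ext_gen_mult:
  assumes "finite E" "i \<in> E" "finite T"
  shows "boundary_coord E (ext_gen i \<otimes>\<^bsub>exterior_algebra E\<^esub> x) T =
    x T - (ext_gen i \<otimes>\<^bsub>exterior_algebra E\<^esub> boundary_coord E x) T"
proof (cases "i \<in> T")
  case False
  have "boundary_coord E (ext_gen i \<otimes>\<^bsub>exterior_algebra E\<^esub> x) T =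
      (\<Sum>l\<in>E - T. if l = i then x T else 0)"
    unfolding boundary_coord_def
    using False assms ext_sign_singleton_square[of i T]
    by (intro sum.cong) (auto simp: ext_gen_mult simp del: exterior_algebra_simps(2))
  then show ?thesis
    using False assms by (simp add: ext_gen_mult sum.delta del: exterior_algebra_simps(2))
next
  case True
  define U where "U = T - {i}"
  have U: "T = insert i U" "i \<notin> U" "finite U"
    using True assms by (auto simp: U_def)
  have "boundary_coord E (ext_gen i \<otimes>\<^bsub>exterior_algebra E\<^esub> x) T =
      (\<Sum>l\<in>E - T. - (ext_sign {i} U * (ext_sign {l} U * x (insert l U))))"
    unfolding boundary_coord_def
  proof (rule sum.cong[OF refl])
    fix l assume l: "l \<in> E - T"
    then have l': "insert l T - {i} = insert l U" "l \<noteq> i" "l \<notin> U" using U by auto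
    have "(ext_gen i \<otimes>\<^bsub>exterior_algebra E\<^esub> x) (insert l T) =
        ext_sign {i} (insert l U) * x (insert l U)"
      using assms(3) True by (subst ext_gen_mult) (simp_all only: l'(1) finite_insert insert_iff simp_thms if_True)
    moreover have "ext_sign {l} T = (if i < l then - 1 else 1) * ext_sign {l} U"
      using ext_sign_singleton_insert[OF U(3,2)] U(1) by simp
    moreover have "ext_sign {i} (insert l U) = (if l < i then - 1 else 1) * ext_sign {i} U"
      using ext_sign_singleton_insert[OF U(3) l'(3)] by simp
    moreover have "i < l \<and> \<not> l < i \<or> l < i \<and> \<not> i < l"
      using l'(2) by auto
    ultimately show "ext_sign {l} T * (ext_gen i \<otimes>\<^bsub>exterior_algebra E\<^esub> x) (insert l T) =
        - (ext_sign {i} U * (ext_sign {l} U * x (insert l U)))"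
      by (elim disjE conjE) (simp_all del: exterior_algebra_simps(2))
  qed
  also have "\<dots> = x T - ext_sign {i} U * (\<Sum>l\<in>E - U. ext_sign {l} U * x (insert l U))"
  proof -
    have *: "E - U = insert i (E - T)" "i \<notin> E - T" using U assms by auto
    have "ext_sign {i} U * (\<Sum>l\<in>E - U. ext_sign {l} U * x (insert l U)) =
        (ext_sign {i} U * ext_sign {i} U) * x T +
        (\<Sum>l\<in>E - T. ext_sign {i} U * (ext_sign {l} U * x (insert l U)))"
      unfolding *(1) using assms(1) *(2) U(1)
      by (simp add: sum_distrib_left distrib_left mult.assoc)
    then show ?thesis
      by (simp only: ext_sign_singleton_square sum_negf) simp
  qed
  finally show ?thesis
    using U by (simp add: ext_gen_mult boundary_coord_def del: exterior_algebra_simps(2))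
qed

lemma boundary_coord_wedge:
  assumes "finite E" "set xs \<subseteq> E" "finite S"
  shows "boundary_coord E (wedge E xs) S = boundary_tuple E xs S"
  using assms(2,3)
proof (induction xs arbitrary: S)
  case Nil
  then show ?case by (simp add: boundary_coord_def wedge_Nil boundary_tuple_apply)
next
  case (Cons i xs)
  then have i: "i \<in> E" and sub: "insert i (set xs) \<subseteq> E" and IH: "finite T \<Longrightarrow>
      boundary_coord E (wedge E xs) T = boundary_tuple E xs T" for T
    by auto
  have "(ext_gen i \<otimes>\<^bsub>exterior_algebra E\<^esub> boundary_coord E (wedge E xs)) S =
      (ext_gen i \<otimes>\<^bsub>exterior_algebra E\<^esub> boundary_tuple E xs) S"
    unfolding ext_gen_mult[OF Cons.prems(2)] using Cons.prems(2) by (simp only: IH finite_Diff)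
  then show ?case
    unfolding wedge_Cons boundary_coord_ext_gen_mult[OF assms(1) i Cons.prems(2)]
      boundary_tuple_Cons[OF sub Cons.prems(2)]
    by (simp only:)
qed

lemma boundary_closed:
  assumes "finite E"
  shows "boundary E x \<in> carrier (exterior_algebra E)"
proof -
  interpret abelian_group "exterior_algebra E"
    by (rule abelian_group_exterior_algebra)
  have "boundary_tuple E (sorted_list_of_set S) \<in> carrier (exterior_algebra E)" if "S \<subseteq> E" for S
    by (rule boundary_tuple_closed) (use that assms finite_subset[OF that] in simp)
  then show ?thesis
    unfolding boundary_def by (intro finsum_closed) auto
qed

lemma boundary_eq_coord:
  assumes "finite E" "x \<in> carrier (exterior_algebra E)" "S \<subseteq> E"
  shows "boundary E x S = boundary_coord E x S"
proof -
  have tup: "set (sorted_list_of_set T) = T" if "T \<subseteq> E" for T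
    using that assms(1) by (auto dest: finite_subset)
  have "boundary E x S = (\<Sum>T\<in>Pow E. x T * boundary_tuple E (sorted_list_of_set T) S)"
    unfolding boundary_def
    using boundary_tuple_closed[of "sorted_list_of_set T" E for T] tup
    by (subst finsum_exterior_algebra_apply) auto
  also have "\<dots> = (\<Sum>T\<in>Pow E. x T * boundary_coord E (wedge E (sorted_list_of_set T)) S)"
    using assms tup by (intro sum.cong) (auto simp: boundary_coord_wedge finite_subset)
  also have "\<dots> = (\<Sum>T\<in>Pow E. \<Sum>l\<in>E - S.
      ext_sign {l} S * (if T = insert l S then x (insert l S) else 0))"
    using tup
    by (intro sum.cong)
      (auto simp: boundary_coord_def wedge_sorted sum_distrib_left mult.left_commute intro!: sum.cong)
  also have "\<dots> = boundary_coord E x S"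
    unfolding boundary_coord_def
    by (subst sum.swap, intro sum.cong)
      (use assms in \<open>auto simp: sum.delta simp flip: sum_distrib_left\<close>)
  finally show ?thesis .
qed

lemma boundary_wedge:
  assumes "finite E" "set xs \<subseteq> E"
  shows "boundary E (wedge E xs) = boundary_tuple E xs"
proof
  fix S show "boundary E (wedge E xs) S = boundary_tuple E xs S"
  proof (cases "S \<subseteq> E")
    case True
    then show ?thesis
      using assms
      by (simp add: boundary_eq_coord boundary_coord_wedge wedge_closed finite_subset
          del: exterior_algebra_simps(1))
  next
    case False
    then show ?thesis
      using boundary_closed[OF assms(1)] boundary_tuple_closed[OF assms(2)] by simp
  qed
qed


subsection \<open>The Orlik-Solomon algebra is a complex algebra\<close>

lemma ideal_smult_closed:
  assumes "complex_algebra A" "ideal I A" "x \<in> I"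
  shows "c \<odot>\<^bsub>A\<^esub> x \<in> I"
proof -
  interpret ideal I A by fact
  interpret M: module complex_ring A using assms(1) by (simp add: complex_algebra_def)
  have x: "x \<in> carrier A" and c: "c \<in> carrier complex_ring"
    using assms(3) by (simp_all add: complex_ring_def)
  have "(c \<odot>\<^bsub>A\<^esub> \<one>\<^bsub>A\<^esub>) \<otimes>\<^bsub>A\<^esub> x = c \<odot>\<^bsub>A\<^esub> x"
    using assms(1) x by (simp add: complex_algebra_def)
  then show ?thesis
    using I_l_closed[OF assms(3), of "c \<odot>\<^bsub>A\<^esub> \<one>\<^bsub>A\<^esub>"] M.smult_closed[OF c] by simp
qed

lemma quotient_algebra_simps [simp]:
  "carrier (quotient_algebra A I) = a_rcosets\<^bsub>A\<^esub> I"
  "mult (quotient_algebra A I) = rcoset_mult A I"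
  "one (quotient_algebra A I) = I +>\<^bsub>A\<^esub> \<one>\<^bsub>A\<^esub>"
  "zero (quotient_algebra A I) = I"
  "add (quotient_algebra A I) = set_add A"
  by (simp_all add: quotient_algebra_def FactRing_def ring.defs module.defs)

lemma quotient_algebra_smult:
  assumes "complex_algebra A" "ideal I A" "x \<in> carrier A"
  shows "c \<odot>\<^bsub>quotient_algebra A I\<^esub> (I +>\<^bsub>A\<^esub> x) = I +>\<^bsub>A\<^esub> (c \<odot>\<^bsub>A\<^esub> x)"
proof -
  interpret ideal I A by fact
  interpret M: module complex_ring A using assms(1) by (simp add: complex_algebra_def)
  have c: "c \<in> carrier complex_ring" by (simp add: complex_ring_def)
  have "I +>\<^bsub>A\<^esub> (c \<odot>\<^bsub>A\<^esub> y) = I +>\<^bsub>A\<^esub> (c \<odot>\<^bsub>A\<^esub> x)" if y: "y \<in> I +>\<^bsub>A\<^esub> x" for y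
  proof -
    obtain h where h: "h \<in> I" "y = h \<oplus>\<^bsub>A\<^esub> x"
      using y by (auto simp: a_r_coset_def')
    have "c \<odot>\<^bsub>A\<^esub> y = c \<odot>\<^bsub>A\<^esub> h \<oplus>\<^bsub>A\<^esub> c \<odot>\<^bsub>A\<^esub> x"
      using h assms(3) M.smult_r_distr[OF c] by simp
    then have "c \<odot>\<^bsub>A\<^esub> y \<in> I +>\<^bsub>A\<^esub> (c \<odot>\<^bsub>A\<^esub> x)"
      using ideal_smult_closed[OF assms(1,2) h(1)] by (auto simp: a_r_coset_def')
    then show ?thesis
      using a_repr_independence[OF _ M.smult_closed[OF c assms(3)] a_subgroup] by simp
  qed
  moreover have "x \<in> I +>\<^bsub>A\<^esub> x" using a_rcos_self assms(3) by blast
  ultimately have "(\<Union>y\<in>I +>\<^bsub>A\<^esub> x. I +>\<^bsub>A\<^esub> (c \<odot>\<^bsub>A\<^esub> y)) = I +>\<^bsub>A\<^esub> (c \<odot>\<^bsub>A\<^esub> x)"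
    by blast
  then show ?thesis
    by (simp add: quotient_algebra_def FactRing_def ring.defs module.defs)
qed

lemma complex_algebra_quotient:
  assumes "complex_algebra A" "ideal I A"
  shows "complex_algebra (quotient_algebra A I)"
proof -
  let ?Q = "quotient_algebra A I"
  interpret ideal I A by fact
  interpret M: module complex_ring A using assms(1) by (simp add: complex_algebra_def)
  have ring_Q: "ring ?Q"
  proof -
    interpret Q: ring "A Quot I" by (rule quotient_is_ring)
    have eq: "carrier ?Q = carrier (A Quot I)" "mult ?Q = mult (A Quot I)" "one ?Q = one (A Quot I)"
      "zero ?Q = zero (A Quot I)" "add ?Q = add (A Quot I)"
      by (simp_all add: FactRing_def)
    show ?thesis
      by (intro ringI abelian_groupI monoidI; unfold eq)
        (auto simp: Q.a_ac Q.m_assoc Q.l_distr Q.r_distr intro: Q.l_neg Q.a_inv_closed)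
  qed
  have carrier_Q: "\<exists>x \<in> carrier A. X = I +>\<^bsub>A\<^esub> x" if "X \<in> carrier ?Q" for X
    using that by (auto simp: A_RCOSETS_def')
  have smult_closed: "c \<odot>\<^bsub>A\<^esub> x \<in> carrier A" if "x \<in> carrier A" for c x
    using M.smult_closed that by (simp add: complex_ring_def)
  note smult = quotient_algebra_smult[OF assms]
  have "module complex_ring ?Q"
  proof (rule moduleI)
    show "abelian_group ?Q" using ring_Q by (rule ringE)
  next
    fix a b X assume "X \<in> carrier ?Q"
    then obtain x where x: "x \<in> carrier A" "X = I +>\<^bsub>A\<^esub> x" using carrier_Q by blast
    show "a \<odot>\<^bsub>?Q\<^esub> X \<in> carrier ?Q"
      using x by (auto simp: smult smult_closed A_RCOSETS_def')
    show "(a \<oplus>\<^bsub>complex_ring\<^esub> b) \<odot>\<^bsub>?Q\<^esub> X = a \<odot>\<^bsub>?Q\<^esub> X \<oplus>\<^bsub>?Q\<^esub> b \<odot>\<^bsub>?Q\<^esub> X"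
      using x M.smult_l_distr[of a b x] by (simp add: smult smult_closed a_rcos_sum complex_ring_def)
    show "(a \<otimes>\<^bsub>complex_ring\<^esub> b) \<odot>\<^bsub>?Q\<^esub> X = a \<odot>\<^bsub>?Q\<^esub> (b \<odot>\<^bsub>?Q\<^esub> X)"
      using x M.smult_assoc1[of a b x] by (simp add: smult smult_closed complex_ring_def)
    show "\<one>\<^bsub>complex_ring\<^esub> \<odot>\<^bsub>?Q\<^esub> X = X"
      using x M.smult_one[of x] by (simp add: smult)
  next
    fix a X Y assume "X \<in> carrier ?Q" "Y \<in> carrier ?Q"
    then obtain x y where xy: "x \<in> carrier A" "X = I +>\<^bsub>A\<^esub> x" "y \<in> carrier A" "Y = I +>\<^bsub>A\<^esub> y"
      using carrier_Q by blast
    show "a \<odot>\<^bsub>?Q\<^esub> (X \<oplus>\<^bsub>?Q\<^esub> Y) = a \<odot>\<^bsub>?Q\<^esub> X \<oplus>\<^bsub>?Q\<^esub> a \<odot>\<^bsub>?Q\<^esub> Y"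
      using xy M.smult_r_distr[of a x y] by (simp add: smult smult_closed a_rcos_sum complex_ring_def)
  qed (rule cring_complex_ring)
  moreover have "(c \<odot>\<^bsub>?Q\<^esub> X) \<otimes>\<^bsub>?Q\<^esub> Y = c \<odot>\<^bsub>?Q\<^esub> (X \<otimes>\<^bsub>?Q\<^esub> Y)"
    "X \<otimes>\<^bsub>?Q\<^esub> (c \<odot>\<^bsub>?Q\<^esub> Y) = c \<odot>\<^bsub>?Q\<^esub> (X \<otimes>\<^bsub>?Q\<^esub> Y)"
    if XY: "X \<in> carrier ?Q" "Y \<in> carrier ?Q" for c X Y
  proof -
    obtain x y where xy: "x \<in> carrier A" "X = I +>\<^bsub>A\<^esub> x" "y \<in> carrier A" "Y = I +>\<^bsub>A\<^esub> y"
      using carrier_Q[OF XY(1)] carrier_Q[OF XY(2)] by blast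
    have bilinear: "(c \<odot>\<^bsub>A\<^esub> x) \<otimes>\<^bsub>A\<^esub> y = c \<odot>\<^bsub>A\<^esub> (x \<otimes>\<^bsub>A\<^esub> y)" "x \<otimes>\<^bsub>A\<^esub> (c \<odot>\<^bsub>A\<^esub> y) = c \<odot>\<^bsub>A\<^esub> (x \<otimes>\<^bsub>A\<^esub> y)"
      using assms(1) xy(1,3) by (simp_all add: complex_algebra_def)
    show "(c \<odot>\<^bsub>?Q\<^esub> X) \<otimes>\<^bsub>?Q\<^esub> Y = c \<odot>\<^bsub>?Q\<^esub> (X \<otimes>\<^bsub>?Q\<^esub> Y)"
      "X \<otimes>\<^bsub>?Q\<^esub> (c \<odot>\<^bsub>?Q\<^esub> Y) = c \<odot>\<^bsub>?Q\<^esub> (X \<otimes>\<^bsub>?Q\<^esub> Y)"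
      using xy by (simp_all add: smult smult_closed rcoset_mult_add bilinear)
  qed
  ultimately show ?thesis
    unfolding complex_algebra_def using ring_Q by (intro conjI allI ballI)
qed

lemma ideal_OS_ideal:
  assumes "finite (ground G)"
  shows "ideal (OS_ideal G) (exterior_algebra (ground G))"
  unfolding OS_ideal_def
  by (rule ring.genideal_ideal)
    (use assms in \<open>auto simp: ring_exterior_algebra boundary_closed simp del: exterior_algebra_simps(1)\<close>)

lemma complex_algebra_OS_algebra:
  "finite (ground G) \<Longrightarrow> complex_algebra (OS_algebra G)"
  by (simp add: OS_algebra_def complex_algebra_quotient complex_algebra_exterior_algebra ideal_OS_ideal)

lemma OS_gen_closed:
  "k \<in> ground G \<Longrightarrow> OS_gen G k \<in> carrier (OS_algebra G)"
  using ext_gen_closed[of k "ground G"]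
  by (auto simp: OS_gen_def OS_algebra_def A_RCOSETS_def' simp del: exterior_algebra_simps(1))

lemma complex_subalgebra_generated:
  assumes "complex_algebra A" "X \<subseteq> carrier A"
  shows "complex_subalgebra (generated_subalgebra A X) A" "X \<subseteq> generated_subalgebra A X"
proof -
  interpret ring A using assms(1) by (simp add: complex_algebra_def)
  interpret M: module complex_ring A using assms(1) by (simp add: complex_algebra_def)
  let ?S = "{H. complex_subalgebra H A \<and> X \<subseteq> H}"
  have ne: "carrier A \<in> ?S"
    using assms(2) carrier_is_subring M.carrier_is_submodule by (simp add: complex_subalgebra_def)
  have sub: "subring (\<Inter>?S) A"
    by (rule subring_Inter) (use ne in \<open>auto simp: complex_subalgebra_def\<close>)
  moreover have "submodule (\<Inter>?S) complex_ring A"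
    by (rule M.submoduleI)
      (use subringE[OF sub] in \<open>auto simp: complex_subalgebra_def intro: submodule.smult_closed\<close>)
  ultimately show "complex_subalgebra (generated_subalgebra A X) A"
    by (simp add: complex_subalgebra_def generated_subalgebra_def hull_def)
  show "X \<subseteq> generated_subalgebra A X"
    unfolding generated_subalgebra_def by (rule hull_subset)
qed

end

theory Submission
  imports Defs
begin

text \<open>Everything rests on a_k - a_i = (a_k - a_j) - (a_i - a_j) in
  \<open>OS_algebra G\<close>: each generator based at i is a difference of two elements of the
  subalgebra based at j. Minimality of a generated subalgebra turns this into one inclusion, and
  exchanging i and j gives the other. \<open>generated_subalgebra_differences_mono\<close> carries
  the argument for any family in a complex algebra.\<close>

lemma generated_subalgebra_differences_mono:
  assumes alg: "complex_algebra A" and f: "\<And>k. k \<in> K \<Longrightarrow> f k \<in> carrier A"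
    and "i \<in> K" "j \<in> K"
  shows "generated_subalgebra A {f k \<ominus>\<^bsub>A\<^esub> f i | k. k \<in> K \<and> k \<noteq> i}
    \<subseteq> generated_subalgebra A {f k \<ominus>\<^bsub>A\<^esub> f j | k. k \<in> K \<and> k \<noteq> j}" (is "_ \<subseteq> ?H")
proof -
  interpret ring A using alg by (simp add: complex_algebra_def)
  have "{f k \<ominus>\<^bsub>A\<^esub> f j | k. k \<in> K \<and> k \<noteq> j} \<subseteq> carrier A"
    using f \<open>j \<in> K\<close> by auto
  note H = complex_subalgebra_generated[OF alg this]
  have sub: "subring ?H A"
    using H(1) by (simp add: complex_subalgebra_def)
  \<comment> \<open>Admitting k = j, where the difference is zero, lets the identity below cover i =
    j and k = j without case splits.\<close>
  have diff_j: "f k \<ominus>\<^bsub>A\<^esub> f j \<in> ?H" if "k \<in> K" for k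
  proof (cases "k = j")
    case True
    then show ?thesis
      using subringE(2)[OF sub] f[OF \<open>j \<in> K\<close>] by (simp add: minus_eq r_neg)
  next
    case False
    then show ?thesis using H(2) that by blast
  qed
  have "f k \<ominus>\<^bsub>A\<^esub> f i \<in> ?H" if "k \<in> K" for k
  proof -
    have "f k \<ominus>\<^bsub>A\<^esub> f i = (f k \<ominus>\<^bsub>A\<^esub> f j) \<oplus>\<^bsub>A\<^esub> \<ominus>\<^bsub>A\<^esub> (f i \<ominus>\<^bsub>A\<^esub> f j)"
      using f[OF that] f[OF \<open>i \<in> K\<close>] f[OF \<open>j \<in> K\<close>]
      by (simp add: minus_eq minus_add minus_minus a_assoc r_neg1 a_comm[of "\<ominus>\<^bsub>A\<^esub> f i" "f j"])
    then show ?thesis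
      using subringE(5,7)[OF sub] diff_j[OF that] diff_j[OF \<open>i \<in> K\<close>] by simp
  qed
  then have "{f k \<ominus>\<^bsub>A\<^esub> f i | k. k \<in> K \<and> k \<noteq> i} \<subseteq> ?H"
    by blast
  then show ?thesis
    \<comment> \<open>Only the left-hand hull is unfolded; \<open>?H\<close> stays folded so that
      \<open>H(1)\<close> supplies the subalgebra premise of \<open>hull_minimal\<close>.\<close>
    unfolding generated_subalgebra_def[of A "{f k \<ominus>\<^bsub>A\<^esub> f i | k. k \<in> K \<and> k \<noteq> i}"]
    using H(1) by (rule hull_minimal)
qed

theorem theorem3p4:
  fixes G :: "nat set_system" and n i j :: nat
  assumes "simple_matroid G"
    and "ground G = {0..n}"
    and "i \<in> {0..n}"
    and "j \<in> {0..n}"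
  shows "pointed_OS_algebra (pointed_at i G) = pointed_OS_algebra (pointed_at j G)"
proof -
  have alg: "complex_algebra (OS_algebra G)"
    using assms(2) by (intro complex_algebra_OS_algebra) simp
  have ij: "i \<in> ground G" "j \<in> ground G"
    using assms by simp_all
  note mono = generated_subalgebra_differences_mono[OF alg OS_gen_closed]
  show ?thesis
    unfolding pointed_OS_algebra_def pointed_at_def Let_def pointed_matroid.simps
    \<comment> \<open>The premise skipped by \<open>_\<close> comes from
      \<open>OS_gen_closed\<close>: the index of each generator lies in the ground set. It becomes
      trivial once the goal fixes the family.\<close>
    by (rule subset_antisym[OF mono[OF _ ij] mono[OF _ ij(2,1)]])
qed

end
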